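(* Let $K$ be a field and let $f,g\in K[x]$ have degree greater than $1$, with $\mathrm{char}\,K$ dividing neither $\deg f$ nor $\deg g$. If $\mathrm{Prep}(f)\neq\mathrm{Prep}(g)$, then $\langle f,g\rangle$ is a free semigroup on two generators.
   Context: $\mathrm{Prep}(f)$ denotes the set of preperiodic points of $f$ in $\mathbb{P}^1(\overline{K})$ (points with finite forward orbit). $\langle f,g\rangle$ is the semigroup generated by $f,g$ under composition; it is free on two generators if distinct words in $f,g$ give distinct polynomials. *)

theory Defs
  imports
    "HOL-Computational_Algebra.Computational_Algebra"
    "HOL-Algebra.Algebraic_Closure_Type"
begin

datatype 'a proj_line = Aff 'a | Infty

(* A nonconstant polynomial fixes the point at infinity; a constant one, viewed as a
   morphism of the projective line, maps it to that constant. *)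
fun poly_proj :: "'a::comm_ring_1 poly \<Rightarrow> 'a proj_line \<Rightarrow> 'a proj_line" where
  "poly_proj p (Aff x) = Aff (poly p x)"
| "poly_proj p Infty = (if Polynomial.degree p = 0 then Aff (poly.coeff p 0) else Infty)"

definition Prep :: "'a::field poly \<Rightarrow> 'a alg_closure proj_line set" where
  "Prep f = {P. finite (range (\<lambda>n. (poly_proj (map_poly to_ac f) ^^ n) P))}"

inductive_set comp_semigroup :: "'a::comm_ring_1 poly \<Rightarrow> 'a poly \<Rightarrow> 'a poly set"
  for f g :: "'a poly" where
  gen1: "f \<in> comp_semigroup f g"
| gen2: "g \<in> comp_semigroup f g"
| comp: "p \<in> comp_semigroup f g \<Longrightarrow> q \<in> comp_semigroup f g \<Longrightarrow>
    pcompose p q \<in> comp_semigroup f g"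

(* The word [b1, ..., bn] stands for the composition of h1, ..., hn, where hi is f if bi
   holds and g otherwise.  The empty word would give the identity [:0, 1:]. *)
definition word_comp :: "'a::comm_ring_1 poly \<Rightarrow> 'a poly \<Rightarrow> bool list \<Rightarrow> 'a poly" where
  "word_comp f g w = foldr (\<lambda>b h. pcompose (if b then f else g) h) w [:0, 1:]"

(* Only nonempty words count, since semigroups need not have an identity. *)
definition free_semigroup_on :: "'a::comm_ring_1 poly \<Rightarrow> 'a poly \<Rightarrow> bool" where
  "free_semigroup_on f g \<longleftrightarrow> inj_on (word_comp f g) {w. w \<noteq> []}"

lemma word_comp_Nil: "word_comp f g [] = [:0, 1:]"
  by (simp add: word_comp_def)

lemma word_comp_Cons: "word_comp f g (b # w) = pcompose (if b then f else g) (word_comp f g w)"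
  by (simp add: word_comp_def)

lemma word_comp_append: "word_comp f g (v @ w) = pcompose (word_comp f g v) (word_comp f g w)"
  by (induction v) (simp_all add: word_comp_Nil word_comp_Cons pcompose_assoc pcompose_pCons)

lemma comp_semigroup_eq_words: "comp_semigroup f g = word_comp f g ` {w. w \<noteq> []}"
proof (intro equalityI subsetI)
  fix p assume "p \<in> comp_semigroup f g"
  then show "p \<in> word_comp f g ` {w. w \<noteq> []}"
  proof induction
    case gen1
    show ?case by (rule image_eqI[of _ _ "[True]"]) (simp_all add: word_comp_def)
  next
    case gen2
    show ?case by (rule image_eqI[of _ _ "[False]"]) (simp_all add: word_comp_def)
  next
    case (comp p q)
    then obtain v w where "v \<noteq> []" "p = word_comp f g v" "q = word_comp f g w" by auto
    then show ?case
      by (intro image_eqI[of _ _ "v @ w"]) (simp_all add: word_comp_append)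
  qed
next
  fix p assume "p \<in> word_comp f g ` {w. w \<noteq> []}"
  then obtain w where "w \<noteq> []" "p = word_comp f g w" by auto
  moreover from \<open>w \<noteq> []\<close> have "word_comp f g w \<in> comp_semigroup f g"
    by (induction w rule: list_nonempty_induct)
      (auto simp: word_comp_Cons word_comp_Nil intro: comp_semigroup.intros)
  ultimately show "p \<in> comp_semigroup f g" by simp
qed

(* The freeness condition says exactly that evaluating words identifies the free
   semigroup on two letters with the semigroup generated by f and g. *)
lemma free_semigroup_on_iff:
  "free_semigroup_on f g \<longleftrightarrow> bij_betw (word_comp f g) {w. w \<noteq> []} (comp_semigroup f g)"
  by (simp add: free_semigroup_on_def bij_betw_def comp_semigroup_eq_words)

end

theory Submission
  imports Defs
begin

text \<open>
  Cancelling on the right, a failure of freeness gives words with \<open>u \<circ> f = v \<circ> g\<close>.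
  Over an algebraically closed field let \<open>n = deg f\<close> and \<open>m = deg g\<close>.  Since \<open>n \<noteq> 0\<close> in the
  field, a formal Boettcher coordinate at infinity conjugates \<open>f\<close> to \<open>s\<^sup>n\<close> and \<open>g\<close> to some power
  series \<open>b s\<^sup>m + \<dots>\<close>.  If \<open>b' s\<^bsup>m + k\<^esup>\<close> were the next nonzero term, then \<open>v \<circ> g\<close> would have a
  nonzero term \<open>k\<close> places after its leading one (because \<open>m, n \<noteq> 0\<close> in the field), while
  \<open>u \<circ> f\<close>, a series in \<open>s\<^sup>n\<close> of larger gap, would not.  So \<open>g\<close> becomes exactly \<open>b s\<^sup>m\<close>.
  Comparing leading coefficients yields \<open>b\<^bsup>N\<^esup> = b\<^bsup>N'\<^esup>\<close> with \<open>N < N'\<close>, so \<open>b\<^sup>e = 1\<close> for some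
  \<open>e > 0\<close>.  As the powers of \<open>n\<close> modulo \<open>e\<close> are eventually periodic, there are \<open>i\<close> and \<open>p > 0\<close>
  with \<open>f\<^bsup>i + pa\<^esup> \<circ> g\<^sup>k = f\<^sup>i \<circ> g\<^sup>k \<circ> f\<^bsup>pa\<^esup>\<close> for all \<open>a\<close> and \<open>k\<close>.  Hence the \<open>g\<close>-orbit of a
  preperiodic point of \<open>f\<close> consists of roots of a single nonzero polynomial
  \<open>f\<^sup>A - f\<^sup>B\<close>, so it is finite; the reverse inclusion is symmetric.
\<close>

subsection \<open>Formal Boettcher coordinates\<close>

lemma fps_mult_nth_low:
  fixes A B :: "'a::comm_ring_1 fps"
  assumes A: "\<And>i. i < p \<Longrightarrow> A $ i = 0" and B: "\<And>i. i < q \<Longrightarrow> B $ i = 0"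
  shows "i < p + q \<Longrightarrow> (A * B) $ i = 0" and "(A * B) $ (p + q) = A $ p * B $ q"
proof -
  have zero: "A $ j * B $ (i - j) = 0" if "j \<le> i" "i \<le> p + q" "j \<noteq> p \<or> i < p + q" for i j
  proof (cases "j < p")
    case False
    then have "i - j < q" using that by linarith
    then show ?thesis using B by simp
  qed (simp add: A)
  show "i < p + q \<Longrightarrow> (A * B) $ i = 0"
    unfolding fps_mult_nth using zero by (intro sum.neutral) auto
  have "(A * B) $ (p + q) = (\<Sum>j\<in>{p}. A $ j * B $ (p + q - j))"
    unfolding fps_mult_nth using zero by (intro sum.mono_neutral_right) auto
  then show "(A * B) $ (p + q) = A $ p * B $ q" by simp
qed

lemma fps_power_nth_low:
  fixes A :: "'a::comm_ring_1 fps"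
  assumes "\<And>i. i < d \<Longrightarrow> A $ i = 0"
  shows "(\<forall>i < n * d. (A ^ n) $ i = 0) \<and> (A ^ n) $ (n * d) = (A $ d) ^ n"
proof (induction n)
  case (Suc n)
  then show ?case
    using fps_mult_nth_low[of d A "n * d" "A ^ n"] assms by simp
qed simp

text \<open>The factor \<^term>\<open>c\<close> on the left avoids the exponent \<^term>\<open>n - 1\<close>.\<close>

lemma fps_power_perturbation:
  fixes A B :: "'a::comm_ring_1 fps"
  assumes A: "\<And>i. i < d \<Longrightarrow> A $ i = 0" "A $ d = c"
    and B: "\<And>i. i < d \<Longrightarrow> B $ i = 0" "B $ d = c"
    and AB: "\<And>i. i < d + j \<Longrightarrow> A $ i = B $ i"
  shows "(\<forall>i < n * d + j. (A ^ n) $ i = (B ^ n) $ i) \<and>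
    c * ((A ^ n) $ (n * d + j) - (B ^ n) $ (n * d + j)) =
      of_nat n * c ^ n * (A $ (d + j) - B $ (d + j))"
proof (induction n)
  case (Suc n)
  let ?D = "A ^ n - B ^ n"
  \<comment> \<open>Both products vanish below \<open>Suc n * d + j\<close>; at that index only the
    lowest coefficients of their factors meet.\<close>
  have split: "A ^ Suc n - B ^ Suc n = A ^ n * (A - B) + B * ?D"
    by (simp add: algebra_simps)
  have An: "\<And>i. i < n * d \<Longrightarrow> (A ^ n) $ i = 0" "(A ^ n) $ (n * d) = c ^ n"
    using fps_power_nth_low[of d A n] A by auto
  have D: "\<And>i. i < n * d + j \<Longrightarrow> ?D $ i = 0"
    and cD: "c * ?D $ (n * d + j) = of_nat n * c ^ n * (A $ (d + j) - B $ (d + j))"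
    using Suc by auto
  have AB': "\<And>i. i < d + j \<Longrightarrow> (A - B) $ i = 0" using AB by simp
  note 1 = fps_mult_nth_low[of "n * d" "A ^ n" "d + j" "A - B", OF An(1) AB']
  note 2 = fps_mult_nth_low[of d B "n * d + j" ?D, OF B(1) D]
  have idx: "n * d + (d + j) = Suc n * d + j" "d + (n * d + j) = Suc n * d + j" by auto
  have low: "(A ^ Suc n - B ^ Suc n) $ i = 0" if "i < Suc n * d + j" for i
    unfolding split using 1(1)[of i] 2(1)[of i] that idx by simp
  have "c * (A ^ Suc n - B ^ Suc n) $ (Suc n * d + j) =
      c * (c ^ n * (A $ (d + j) - B $ (d + j)) + c * ?D $ (n * d + j))"
    unfolding split using 1(2) 2(2) by (simp add: idx An B)
  also have "\<dots> = of_nat (Suc n) * c ^ Suc n * (A $ (d + j) - B $ (d + j))"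
    unfolding cD by (simp add: algebra_simps)
  finally show ?case using low by simp
qed simp

text \<open>
  In \<open>\<phi> \<circ> F = \<phi>\<^sup>n\<close> the coefficient at \<open>n + k - 1\<close> involves \<open>\<phi>\<^sub>k\<close> only through the term
  \<open>n c\<^bsup>n - 1\<^esup> \<phi>\<^sub>k\<close> of \<open>\<phi>\<^sup>n\<close>, which determines \<open>\<phi>\<^sub>k\<close> recursively.
\<close>

fun boettcher_coeff :: "'a::field fps \<Rightarrow> nat \<Rightarrow> 'a \<Rightarrow> nat \<Rightarrow> 'a" where
  "boettcher_coeff F n c k =
    (if k = 0 then 0 else if k = 1 then c
     else let Q = Abs_fps (\<lambda>i. if i < k then boettcher_coeff F n c i else 0)
          in c * ((Q oo F) - Q ^ n) $ (n + k - 1) / (of_nat n * c ^ n))"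

declare boettcher_coeff.simps [simp del]

text \<open>Coefficientwise, both sides vanish below index \<open>n\<close>; index \<open>n\<close>
  requires \<open>c * F $ n = c ^ n\<close>; each later index is solved for the next coefficient,
  dividing by \<open>of_nat n * c ^ n\<close>.\<close>

lemma boettcher_exists:
  fixes F :: "'a::field fps"
  assumes F: "\<And>i. i < n \<Longrightarrow> F $ i = 0" and n: "n \<ge> 2" "of_nat n \<noteq> (0 :: 'a)"
    and c: "c \<noteq> 0" "c ^ (n - 1) = F $ n"
  obtains \<phi> where "\<phi> $ 0 = 0" "\<phi> $ 1 = c" "\<phi> oo F = \<phi> ^ n"
proof
  define \<phi> where "\<phi> = Abs_fps (boettcher_coeff F n c)"
  show 0: "\<phi> $ 0 = 0" and 1: "\<phi> $ 1 = c"
    by (simp_all add: \<phi>_def boettcher_coeff.simps)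
  have low: "\<And>i. i < 1 \<Longrightarrow> \<phi> $ i = 0" using 0 by simp
  have Fpow: "(F ^ l) $ i = 0" if "i < l * n" for l i
    using fps_power_nth_low[of n F l] F that by blast
  have "(\<phi> oo F) $ m = (\<phi> ^ n) $ m" for m
  proof -
    consider "m < n" | "m = n" | k where "k \<ge> 2" "m = n + k - 1"
    proof (cases "m \<le> n")
      case False
      then have "m - n + 1 \<ge> 2" "m = n + (m - n + 1) - 1" by auto
      then show ?thesis using that(3) by blast
    qed (use that in force)
    then show ?thesis
    proof cases
      case 1
      have "\<phi> $ i * (F ^ i) $ m = 0" for i
        using 1 Fpow[of m i] 0 by (cases i) auto
      then have "(\<phi> oo F) $ m = 0"
        unfolding fps_compose_nth by (intro sum.neutral ballI)
      then show ?thesis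
        using 1 fps_power_nth_low[of 1 \<phi> n, OF low] by simp
    next
      case 2
      have "\<phi> $ i * (F ^ i) $ n = 0" if "i \<noteq> 1" for i
      proof (cases "i = 0")
        case False
        then have "i * n \<ge> 2 * n" using that by (intro mult_right_mono) auto
        then have "n < i * n" using n by linarith
        then show ?thesis using Fpow by simp
      qed (simp add: 0)
      then have "(\<phi> oo F) $ n = (\<Sum>i\<in>{1}. \<phi> $ i * (F ^ i) $ n)"
        unfolding fps_compose_nth using n by (intro sum.mono_neutral_right) auto
      also have "\<dots> = c * c ^ (n - 1)" using 1 c by simp
      also have "\<dots> = c ^ n" using n by (simp flip: power_Suc)
      finally show ?thesis
        using 2 1 fps_power_nth_low[of 1 \<phi> n, OF low] by simp
    next
      case (3 k)
      define Q where "Q = Abs_fps (\<lambda>i. if i < k then boettcher_coeff F n c i else 0)"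
      have Q: "Q $ i = (if i < k then \<phi> $ i else 0)" for i
        by (simp add: Q_def \<phi>_def)
      have \<phi>k: "\<phi> $ k = c * ((Q oo F) - Q ^ n) $ m / (of_nat n * c ^ n)"
        unfolding \<phi>_def fps_nth_Abs_fps using 3 
        by (subst boettcher_coeff.simps) (simp add: Q_def Let_def)
      \<comment> \<open>The truncation \<open>Q\<close> suffices: for i >= k the power
        \<open>F ^ i\<close> starts at \<open>i * n\<close>, beyond \<open>m = n + k - 1\<close> as
        n, k >= 2.\<close>
      have "(\<phi> oo F) $ m = (Q oo F) $ m"
        unfolding fps_compose_nth
      proof (intro sum.cong refl)
        fix i
        show "\<phi> $ i * (F ^ i) $ m = Q $ i * (F ^ i) $ m"
        proof (cases "i < k")
          case False
          then have "i * n \<ge> k * n" by simp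
          moreover have "n + k - 1 < k * n"
          proof -
            obtain n' k' where "n = 2 + n'" "k = 2 + k'"
              using le_Suc_ex[OF n(1)] le_Suc_ex[OF 3(1)] by blast
            then show ?thesis by simp
          qed
          ultimately have "m < i * n" using 3 by linarith
          then show ?thesis using Fpow by simp
        qed (simp add: Q)
      qed
      moreover have "c * ((\<phi> ^ n) $ (n * 1 + (k - 1)) - (Q ^ n) $ (n * 1 + (k - 1))) =
          of_nat n * c ^ n * (\<phi> $ (1 + (k - 1)) - Q $ (1 + (k - 1)))"
      proof (rule fps_power_perturbation[THEN conjunct2])
        show "Q $ 1 = c" using 1 3 by (simp add: Q)
        show "\<And>i. i < 1 \<Longrightarrow> Q $ i = 0" using 0 by (simp add: Q)
        show "\<And>i. i < 1 + (k - 1) \<Longrightarrow> \<phi> $ i = Q $ i" using 3 by (simp add: Q)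
      qed (use low 1 in auto)
      then have "c * ((\<phi> ^ n) $ m - (Q ^ n) $ m) = of_nat n * c ^ n * \<phi> $ k"
        using 3 by (simp add: Q)
      then have "c * ((\<phi> ^ n) $ m - (Q ^ n) $ m) = c * ((Q oo F) $ m - (Q ^ n) $ m)"
        using n c by (simp add: \<phi>k)
      ultimately show ?thesis using c by simp
    qed
  qed
  then show "\<phi> oo F = \<phi> ^ n" by (simp add: fps_eq_iff)
qed

section \<open>Composition of series that are monomials up to a gap\<close>

definition monom_upto :: "nat \<Rightarrow> nat \<Rightarrow> 'a::zero \<Rightarrow> 'a fps \<Rightarrow> bool" where
  "monom_upto k d c A \<longleftrightarrow> (\<forall>i < d + k. A $ i = (if i = d then c else 0))"

text \<open>Up to index \<open>d * e + k\<close> only the term \<open>a * B ^ d\<close> survives: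
  \<open>A\<close> has no other coefficient below \<open>d + k\<close>, and \<open>B ^ l\<close>
  with l >= d + k starts at \<open>l * e\<close> or later, too late because e >= 2. So the
  coefficient at the gap comes from \<open>B\<close> alone.\<close>

lemma monom_upto_compose:
  fixes A B :: "'a::comm_ring_1 fps"
  assumes A: "monom_upto k d a A" and B: "monom_upto k e b B" and "k \<ge> 1" "e \<ge> 2"
  shows "monom_upto k (d * e) (a * b ^ d) (A oo B)"
    and "b * (A oo B) $ (d * e + k) = a * of_nat d * b ^ d * B $ (e + k)"
proof -
  define M where "M = fps_const b * fps_X ^ e"
  have M: "M $ i = (if i = e then b else 0)" for i
    by (simp add: M_def fps_X_power_nth)
  have Mpow: "(M ^ d) $ i = (if i = d * e then b ^ d else 0)" for i
    by (simp add: M_def power_mult_distrib fps_const_power fps_X_power_nth mult.commute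
          flip: power_mult)
  have Blow: "\<And>i. i < e \<Longrightarrow> B $ i = 0" using B by (simp add: monom_upto_def)
  have comp: "(A oo B) $ i = a * (B ^ d) $ i" if "i \<le> d * e + k" for i
  proof -
    have "A $ l * (B ^ l) $ i = 0" if "l \<noteq> d" for l
    proof (cases "l < d + k")
      case False
      then have "(d + k) * e \<le> l * e" by simp
      moreover have "k * e \<ge> k * 2" using assms by simp
      ultimately have "i < l * e"
        using \<open>i \<le> d * e + k\<close> \<open>k \<ge> 1\<close> unfolding add_mult_distrib by linarith
      then show ?thesis using fps_power_nth_low[of e B l] Blow by simp
    qed (use A that in \<open>simp add: monom_upto_def\<close>)
    \<comment> \<open>The intersection is empty if d > i; then \<open>B ^ d\<close> has no
      coefficient at i either.\<close>
    then have "(A oo B) $ i = (\<Sum>l\<in>{0..i} \<inter> {d}. A $ l * (B ^ l) $ i)"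
      unfolding fps_compose_nth by (intro sum.mono_neutral_right) auto
    also have "\<dots> = a * (B ^ d) $ i"
    proof (cases "d \<le> i")
      case True
      then have "{0..i} \<inter> {d} = {d}" by auto
      then show ?thesis using A \<open>k \<ge> 1\<close> by (simp add: monom_upto_def)
    next
      case False
      moreover have "d * 1 \<le> d * e" using \<open>e \<ge> 2\<close> by (intro mult_left_mono) auto
      ultimately have "i < d * e" by linarith
      then show ?thesis using False fps_power_nth_low[of e B d] Blow by simp
    qed
    finally show ?thesis .
  qed
  have pert: "(\<forall>i < d * e + k. (B ^ d) $ i = (M ^ d) $ i) \<and>
    b * ((B ^ d) $ (d * e + k) - (M ^ d) $ (d * e + k)) =
      of_nat d * b ^ d * (B $ (e + k) - M $ (e + k))"
    using B \<open>k \<ge> 1\<close> by (intro fps_power_perturbation) (auto simp: M monom_upto_def)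
  then show "monom_upto k (d * e) (a * b ^ d) (A oo B)"
    using \<open>k \<ge> 1\<close> by (auto simp: monom_upto_def comp Mpow)
  have "b * (B ^ d) $ (d * e + k) = of_nat d * b ^ d * B $ (e + k)"
    using pert \<open>k \<ge> 1\<close> by (simp add: M Mpow)
  then show "b * (A oo B) $ (d * e + k) = a * of_nat d * b ^ d * B $ (e + k)"
    by (simp add: comp mult.left_commute mult.assoc)
qed

subsection \<open>Polynomials as power series at infinity\<close>

text \<open>The expansion of \<open>1 / p(1/s)\<close> in powers of \<open>s\<close>.\<close>

definition fps_at_infinity :: "'a::field poly \<Rightarrow> 'a fps" where
  "fps_at_infinity p = fps_X ^ Polynomial.degree p * inverse (fps_of_poly (reflect_poly p))"

lemma fps_to_fls_compose_fps_of_poly: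
  fixes \<beta> :: "'a::field fps"
  assumes "\<beta> $ 0 = 0"
  shows "fps_to_fls (fps_of_poly p oo \<beta>) = poly (map_poly fls_const p) (fps_to_fls \<beta>)"
proof (induction p)
  case (pCons a p)
  then show ?case
    using assms
    by (simp add: map_poly_pCons fps_of_poly_pCons fps_compose_add_distrib
          fps_compose_mult_distrib fls_times_fps_to_fls mult.commute)
qed simp

lemma map_poly_reflect_poly_fls_const:
  "map_poly fls_const (reflect_poly p) = reflect_poly (map_poly fls_const (p :: 'a::field poly))"
  by (intro poly_eqI) (simp add: coeff_map_poly coeff_reflect_poly degree_map_poly)

text \<open>At \<beta> the reflected polynomial is \<beta>^d p(1/\<beta>) with d the degree of p,
  and the powers of \<beta> cancel. Laurent series give a meaning to 1/\<beta>.\<close>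

lemma fps_at_infinity_compose:
  fixes \<beta> :: "'a::field fps"
  assumes "\<beta> $ 0 = 0" "\<beta> \<noteq> 0" "p \<noteq> 0"
  shows "fps_to_fls (fps_at_infinity p oo \<beta>) =
    inverse (poly (map_poly fls_const p) (inverse (fps_to_fls \<beta>)))"
proof -
  let ?R = "fps_of_poly (reflect_poly p)" and ?d = "Polynomial.degree p"
  have "fps_at_infinity p * ?R = fps_X ^ ?d"
    using assms by (simp add: fps_at_infinity_def mult.assoc inverse_mult_eq_1)
  then have "(fps_at_infinity p oo \<beta>) * (?R oo \<beta>) = \<beta> ^ ?d"
    using assms by (metis fps_X_fps_compose_startby0 fps_compose_mult_distrib fps_compose_power)
  then have "fps_to_fls (fps_at_infinity p oo \<beta>) * fps_to_fls (?R oo \<beta>) = fps_to_fls \<beta> ^ ?d"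
    by (metis fls_times_fps_to_fls fps_to_fls_power)
  moreover have "fps_to_fls (?R oo \<beta>) =
      fps_to_fls \<beta> ^ ?d * poly (map_poly fls_const p) (inverse (fps_to_fls \<beta>))"
    using assms
    by (simp add: fps_to_fls_compose_fps_of_poly map_poly_reflect_poly_fls_const
          poly_reflect_poly_nz degree_map_poly)
  ultimately have "poly (map_poly fls_const p) (inverse (fps_to_fls \<beta>)) *
      fps_to_fls (fps_at_infinity p oo \<beta>) = 1"
    using assms by (auto simp: field_simps)
  then show ?thesis by (rule inverse_unique[symmetric])
qed

lemma fps_at_infinity_nonzero:
  assumes "p \<noteq> 0"
  shows "fps_at_infinity p \<noteq> 0"
  using assms by (simp add: fps_at_infinity_def fps_inverse_eq_0_iff)

lemma fps_at_infinity_nth: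
  "i < Polynomial.degree p \<Longrightarrow> fps_at_infinity p $ i = 0"
  "fps_at_infinity p $ Polynomial.degree p = inverse (Polynomial.lead_coeff p)"
  by (simp_all add: fps_at_infinity_def fps_X_power_mult_nth)

lemma fps_to_fls_fps_at_infinity:
  assumes "p \<noteq> 0"
  shows "fps_to_fls (fps_at_infinity p) = inverse (poly (map_poly fls_const p) (inverse fls_X))"
  using fps_at_infinity_compose[of fps_X p] assms by simp

lemma map_poly_pcompose_hom:
  fixes h :: "'a::comm_ring_1 \<Rightarrow> 'b::comm_ring_1"
  assumes h: "h 0 = 0" "\<And>a b. h (a + b) = h a + h b" "\<And>a b. h (a * b) = h a * h b"
  shows "map_poly h (pcompose p q) = pcompose (map_poly h p) (map_poly h q)"
proof -
  have add: "map_poly h (p + q) = map_poly h p + map_poly h q" for p q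
    by (intro poly_eqI) (simp add: coeff_map_poly h)
  have smult: "map_poly h (Polynomial.smult a p) = Polynomial.smult (h a) (map_poly h p)" for a p
    by (intro poly_eqI) (simp add: coeff_map_poly h)
  have mult: "map_poly h (p * q) = map_poly h p * map_poly h q" for p q
    by (induction p) (simp_all add: map_poly_pCons add smult h)
  show ?thesis
    by (induction p) (simp_all add: map_poly_pCons pcompose_pCons add mult h)
qed

text \<open>Both sides expand 1/p(q(1/s)).\<close>

lemma fps_at_infinity_pcompose:
  fixes p q :: "'a::field poly"
  assumes "Polynomial.degree p > 0" "Polynomial.degree q > 0"
  shows "fps_at_infinity (pcompose p q) = fps_at_infinity p oo fps_at_infinity q"
proof -
  have nz: "p \<noteq> 0" "q \<noteq> 0" "pcompose p q \<noteq> 0"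
    using assms degree_pcompose[of p q] by (auto simp: pcompose_eq_0_iff)
  have "fps_to_fls (fps_at_infinity (pcompose p q)) =
      fps_to_fls (fps_at_infinity p oo fps_at_infinity q)"
    using nz assms by (simp add: fps_to_fls_fps_at_infinity fps_at_infinity_compose fps_at_infinity_nonzero
        fps_at_infinity_nth map_poly_pcompose_hom poly_pcompose flip: fls_plus_const)
  then show ?thesis by simp
qed

text \<open>Equal expansions make \<open>p - q\<close> vanish at 1/s; a nonzero difference would
  then have expansion \<open>inverse 0 = 0\<close>.\<close>

lemma fps_at_infinity_inject:
  fixes p q :: "'a::field poly"
  assumes "fps_at_infinity p = fps_at_infinity q" "p \<noteq> 0" "q \<noteq> 0"
  shows "p = q"
proof -
  have "poly (map_poly fls_const p) (inverse fls_X) = poly (map_poly fls_const q) (inverse fls_X)"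
    using fps_to_fls_fps_at_infinity[of p] fps_to_fls_fps_at_infinity[of q] assms by simp
  moreover have "map_poly fls_const (p - q) = map_poly fls_const p - map_poly fls_const q"
    by (intro poly_eqI) (simp add: coeff_map_poly flip: fls_minus_const)
  ultimately have "poly (map_poly fls_const (p - q)) (inverse fls_X) = 0" by simp
  then have "fps_to_fls (fps_at_infinity (p - q)) = 0 \<or> p - q = 0"
    using fps_to_fls_fps_at_infinity[of "p - q"] by auto
  then show ?thesis using fps_at_infinity_nonzero[of "p - q"] by auto
qed

text \<open>Conjugation by the Boettcher coordinate of \<open>f\<close> in s = 1/x, recorded through
  the five properties used later.\<close>

lemma boettcher_conjugation:
  fixes f :: "'a::alg_closed_field poly"
  assumes deg: "Polynomial.degree f \<ge> 2" and tame: "of_nat (Polynomial.degree f) \<noteq> (0 :: 'a)"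
  obtains \<kappa> :: "'a poly \<Rightarrow> 'a fps" where
    "\<kappa> f = fps_X ^ Polynomial.degree f"
    "\<kappa> [:0, 1:] = fps_X"
    "\<And>p q. Polynomial.degree p > 0 \<Longrightarrow> Polynomial.degree q > 0 \<Longrightarrow>
      \<kappa> (pcompose p q) = \<kappa> p oo \<kappa> q"
    "\<And>p q. Polynomial.degree p > 0 \<Longrightarrow> Polynomial.degree q > 0 \<Longrightarrow> \<kappa> p = \<kappa> q \<Longrightarrow> p = q"
    "\<And>p. Polynomial.degree p > 0 \<Longrightarrow> subdegree (\<kappa> p) = Polynomial.degree p"
proof -
  let ?n = "Polynomial.degree f" and ?F = fps_at_infinity
  have "?F f $ ?n \<noteq> 0" using deg by (auto simp: fps_at_infinity_nth)
  \<comment> \<open>Algebraic closure supplies the root that \<open>boettcher_exists\<close>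
    demands.\<close>
  moreover obtain c where c: "c ^ (?n - 1) = ?F f $ ?n"
    using nth_root_exists[of "?n - 1" "?F f $ ?n"] deg by auto
  ultimately have "c \<noteq> 0" using deg by (auto simp: power_0_left)
  obtain \<phi> where \<phi>: "\<phi> $ 0 = 0" "\<phi> $ 1 = c" "\<phi> oo ?F f = \<phi> ^ ?n"
    by (rule boettcher_exists[of ?n "?F f" c]) (use deg tame c \<open>c \<noteq> 0\<close> fps_at_infinity_nth(1) in auto)
  define \<psi> where "\<psi> = fps_inv \<phi>"
  have \<psi>: "\<phi> oo \<psi> = fps_X" "\<psi> oo \<phi> = fps_X" "\<psi> $ 0 = 0"
    using fps_inv_right[of \<phi>] fps_inv[of \<phi>] \<phi> \<open>c \<noteq> 0\<close> by (simp_all add: \<psi>_def fps_inv_def)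
  have sub\<phi>: "subdegree \<phi> = 1" using \<phi> \<open>c \<noteq> 0\<close> by (intro subdegreeI) auto
  have "subdegree \<phi> * subdegree \<psi> = 1"
    using arg_cong[OF \<psi>(1), of subdegree] \<psi>(3) by simp
  then have sub\<psi>: "subdegree \<psi> = 1" by simp
  define \<kappa> where "\<kappa> p = \<phi> oo ?F p oo \<psi>" for p
  have F0: "?F p $ 0 = 0" if "Polynomial.degree p > 0" for p :: "'a poly"
    using fps_at_infinity_nth(1)[OF that] .
  have subF: "subdegree (?F p) = Polynomial.degree p" if "Polynomial.degree p > 0" for p :: "'a poly"
    using that fps_at_infinity_nth(1)[of _ p] fps_at_infinity_nth(2)[of p] by (intro subdegreeI) auto
  have \<kappa>\<phi>: "\<kappa> p oo \<phi> = \<phi> oo ?F p" for p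
    using fps_compose_assoc[of \<phi> \<psi> "\<phi> oo ?F p"] \<phi> \<psi> by (simp add: \<kappa>_def)
  show ?thesis
  proof
    show "\<kappa> f = fps_X ^ ?n"
      using \<phi> \<psi> by (simp add: \<kappa>_def flip: fps_compose_power)
    have "?F [:0, 1 :: 'a:] = fps_X"
      by (simp add: fps_at_infinity_def reflect_poly_def)
    then show "\<kappa> [:0, 1:] = fps_X" by (simp add: \<kappa>_def \<psi>)
  next
    fix p q :: "'a poly" assume pq: "Polynomial.degree p > 0" "Polynomial.degree q > 0"
    have "\<kappa> p oo \<kappa> q = \<kappa> p oo (\<phi> oo (?F q oo \<psi>))"
      using pq \<phi> \<psi> F0 by (simp add: \<kappa>_def fps_compose_assoc)
    also have "\<dots> = (\<kappa> p oo \<phi>) oo (?F q oo \<psi>)"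
      using pq \<phi> \<psi> F0 by (intro fps_compose_assoc) auto
    also have "\<dots> = \<phi> oo (?F p oo ?F q) oo \<psi>"
      unfolding \<kappa>\<phi> using pq \<phi> \<psi> F0 by (simp add: fps_compose_assoc)
    finally show "\<kappa> (pcompose p q) = \<kappa> p oo \<kappa> q"
      using pq by (simp add: \<kappa>_def fps_at_infinity_pcompose)
    assume "\<kappa> p = \<kappa> q"
    then have "\<phi> oo ?F p = \<phi> oo ?F q" by (metis \<kappa>\<phi>)
    then have "\<psi> oo (\<phi> oo ?F p) = \<psi> oo (\<phi> oo ?F q)" by simp
    then have "?F p = ?F q"
      using pq \<phi> \<psi> F0 by (simp add: fps_compose_assoc)
    then show "p = q" using pq by (intro fps_at_infinity_inject) auto
  next
    fix p :: "'a poly" assume p: "Polynomial.degree p > 0"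
    then show "subdegree (\<kappa> p) = Polynomial.degree p"
      using \<phi> \<psi> F0[OF p] by (simp add: \<kappa>_def subF sub\<phi> sub\<psi>)
  qed
qed

subsection \<open>Degrees and leading coefficients of words\<close>

fun word_degree :: "nat \<Rightarrow> nat \<Rightarrow> bool list \<Rightarrow> nat" where
  "word_degree n m [] = 1"
| "word_degree n m (x # w) = (if x then n else m) * word_degree n m w"

text \<open>The exponent of \<open>b\<close> in the leading coefficient of a word in \<open>x\<^sup>n\<close> and \<open>b x\<^sup>m\<close>.\<close>

fun word_exponent :: "nat \<Rightarrow> nat \<Rightarrow> bool list \<Rightarrow> nat" where
  "word_exponent n m [] = 0"
| "word_exponent n m (x # w) =
    (if x then n * word_exponent n m w else Suc (m * word_exponent n m w))"

lemma word_degree_append: "word_degree n m (v @ w) = word_degree n m v * word_degree n m w"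
  by (induction v) auto

lemma word_exponent_append:
  "word_exponent n m (v @ w) = word_exponent n m v + word_degree n m v * word_exponent n m w"
  by (induction v) (auto simp: algebra_simps)

lemma word_degree_replicate:
  "word_degree n m (replicate j x) = (if x then n else m) ^ j"
  by (induction j) auto

lemma word_exponent_replicate_True: "word_exponent n m (replicate j True) = 0"
  by (induction j) auto

lemma word_degree_pos: "n > 0 \<Longrightarrow> m > 0 \<Longrightarrow> word_degree n m w > 0"
  by (induction w) auto

lemma word_degree_ge_2:
  assumes "n \<ge> 2" "m \<ge> 2" "w \<noteq> []"
  shows "word_degree n m w \<ge> 2"
proof -
  obtain x v where "w = x # v" using assms by (cases w) auto
  moreover have "word_degree n m v \<ge> 1" using word_degree_pos[of n m v] assms by simp
  then have "(if x then n else m) * word_degree n m v \<ge> 2 * 1"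
    using assms by (intro mult_mono) auto
  ultimately show ?thesis by simp
qed

lemma degree_word_comp:
  fixes f g :: "'a::field poly"
  shows "Polynomial.degree (word_comp f g w) =
    word_degree (Polynomial.degree f) (Polynomial.degree g) w"
  by (induction w) (auto simp: word_comp_Nil word_comp_Cons degree_pcompose)

text \<open>Powers of \<open>g\<close> are extremal: there
  \<open>(m - 1) * (1 + m + ... + m^(k-1)) = m^k - 1\<close>.\<close>

lemma word_exponent_bound:
  assumes "n > 0" "m > 0"
  shows "(m - 1) * word_exponent n m w < word_degree n m w"
proof (induction w)
  case (Cons x w)
  obtain m' where m: "m = Suc m'" using assms by (cases m) auto
  let ?E = "word_exponent n m w" and ?D = "word_degree n m w"
  have IH: "m' * ?E < ?D" using Cons by (simp add: m)
  show ?case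
  proof (cases x)
    case True
    have "n * (m' * ?E) < n * ?D" using IH assms by simp
    then show ?thesis using True by (simp add: m mult.left_commute)
  next
    case False
    have "Suc m' * Suc (m' * ?E) \<le> Suc m' * ?D" using IH by (intro mult_left_mono) auto
    then show ?thesis using False by (simp add: m algebra_simps)
  qed
qed simp

text \<open>Separates the exponents of b in a relation: \<open>u @ [True]\<close> has that of
  \<open>u\<close>, while \<open>v @ [False]\<close> has that of \<open>v\<close> plus the degree of
  \<open>v\<close>. Otherwise the preceding bound gives n (m - 1) < m.\<close>

lemma word_exponent_less_degree:
  assumes nm: "n \<ge> 2" "m \<ge> 2" and eq: "word_degree n m u * n = word_degree n m v * m"
  shows "word_exponent n m u < word_degree n m v"
proof (rule ccontr)
  let ?D = "word_degree n m"
  assume "\<not> ?thesis"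
  then have "(m - 1) * ?D v \<le> (m - 1) * word_exponent n m u" by (intro mult_left_mono) auto
  also have "\<dots> < ?D u" using nm by (intro word_exponent_bound) auto
  finally have "n * ((m - 1) * ?D v) < n * ?D u" using nm by simp
  also have "\<dots> = m * ?D v" using eq by (simp add: mult.commute)
  finally have "n * (m - 1) < m" by (metis mult.assoc mult_less_cancel2)
  moreover have "2 * (m - 1) \<le> n * (m - 1)" using nm by (intro mult_right_mono) auto
  ultimately show False using nm by linarith
qed

lemma of_nat_word_degree_nonzero:
  assumes "of_nat n \<noteq> (0 :: 'a::field)" "of_nat m \<noteq> (0 :: 'a)"
  shows "of_nat (word_degree n m w) \<noteq> (0 :: 'a)"
  using assms by (induction w) auto

subsection \<open>Consequences of a relation\<close>

lemma power_mod_eventually_periodic: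
  fixes n e :: nat
  assumes "e > 0"
  obtains i p where "p > 0" "\<And>a. n ^ (i + p * a) mod e = n ^ i mod e"
proof -
  have "finite (range (\<lambda>j. n ^ j mod e))"
    by (rule finite_subset[of _ "{..<e}"]) (use assms in auto)
  then have "\<not> inj (\<lambda>j. n ^ j mod e)"
    using finite_imageD infinite_UNIV_nat by blast
  then obtain i j where "i < j" and ij: "n ^ j mod e = n ^ i mod e"
    by (auto simp: inj_def) (metis linorder_neqE_nat)
  define p where "p = j - i"
  have "n ^ (i + p * a) mod e = n ^ i mod e" for a
  proof (induction a)
    case (Suc a)
    have "n ^ (i + p * Suc a) = n ^ (i + p * a) * n ^ p" by (simp add: power_add)
    then have "n ^ (i + p * Suc a) mod e = (n ^ (i + p * a) mod e) * n ^ p mod e"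
      by (simp only: mod_mult_left_eq)
    also have "\<dots> = n ^ (i + p) mod e"
      unfolding Suc by (simp only: mod_mult_left_eq power_add)
    also have "\<dots> = n ^ j mod e" using \<open>i < j\<close> by (simp add: p_def)
    finally show ?case using ij by simp
  qed simp
  then show ?thesis using that[of p i] \<open>i < j\<close> by (simp add: p_def)
qed

lemma power_eq_of_mod_eq:
  fixes b :: "'a::monoid_mult"
  assumes "b ^ e = 1" "s mod e = t mod e"
  shows "b ^ s = b ^ t"
proof -
  have "b ^ s = b ^ (s mod e)" for s
  proof -
    have "b ^ s = b ^ (e * (s div e) + s mod e)" by simp
    then show ?thesis unfolding power_add power_mult assms(1) by simp
  qed
  then show ?thesis using assms(2) by metis
qed

text \<open>Words become monomials, determined by degree and exponent of \<open>b\<close> modulo e.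
  Copies of \<open>f\<close> on the right leave the exponent unchanged; on the left they multiply it
  by a power of n.\<close>

lemma relation_imp_semicommuting_iterates:
  fixes f g :: "'a::alg_closed_field poly"
  assumes degs: "Polynomial.degree f \<ge> 2" "Polynomial.degree g \<ge> 2"
    and tame: "of_nat (Polynomial.degree f) \<noteq> (0 :: 'a)"
      "of_nat (Polynomial.degree g) \<noteq> (0 :: 'a)"
    and rel: "word_comp f g (u @ [True]) = word_comp f g (v @ [False])"
  obtains i p where "p > 0"
    "\<And>a k. word_comp f g (replicate (i + p * a) True @ replicate k False) =
      word_comp f g (replicate i True @ replicate k False @ replicate (p * a) True)"
proof (rule boettcher_conjugation[OF degs(1) tame(1)])
  fix \<kappa> :: "'a poly \<Rightarrow> 'a fps"
  assume \<kappa>f': "\<kappa> f = fps_X ^ Polynomial.degree f" and \<kappa>X: "\<kappa> [:0, 1:] = fps_X"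
    and \<kappa>comp: "\<And>p q. Polynomial.degree p > 0 \<Longrightarrow> Polynomial.degree q > 0 \<Longrightarrow>
      \<kappa> (pcompose p q) = \<kappa> p oo \<kappa> q"
    and \<kappa>inj: "\<And>p q. Polynomial.degree p > 0 \<Longrightarrow> Polynomial.degree q > 0 \<Longrightarrow>
      \<kappa> p = \<kappa> q \<Longrightarrow> p = q"
    and \<kappa>sub: "\<And>p. Polynomial.degree p > 0 \<Longrightarrow> subdegree (\<kappa> p) = Polynomial.degree p"
  define n m where "n = Polynomial.degree f" and "m = Polynomial.degree g"
  let ?D = "word_degree n m" and ?E = "word_exponent n m" and ?W = "word_comp f g"
  have nm: "n \<ge> 2" "m \<ge> 2" "n > 0" "m > 0" using degs by (auto simp: n_def m_def)
  have \<kappa>f: "\<kappa> f = fps_X ^ n" using \<kappa>f' by (simp add: n_def)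
  have degW: "Polynomial.degree (?W w) = ?D w" "Polynomial.degree (?W w) > 0" for w
    using degree_word_comp[of f g w] word_degree_pos[of n m w] nm by (auto simp: n_def m_def)
  have \<kappa>W: "\<kappa> (?W (x @ y)) = \<kappa> (?W x) oo \<kappa> (?W y)" for x y
    unfolding word_comp_append by (intro \<kappa>comp degW(2))
  define b where "b = \<kappa> g $ m"
  have subg: "subdegree (\<kappa> g) = m" using \<kappa>sub[of g] nm by (simp add: m_def)
  have "b \<noteq> 0"
    using subg nm nth_subdegree_nonzero[of "\<kappa> g"] by (force simp: b_def)
  have \<kappa>f_upto: "monom_upto k n 1 (\<kappa> f)" for k
    by (simp add: \<kappa>f monom_upto_def fps_X_power_nth)
  have letters: "?W [True] = f" "?W [False] = g" by (simp_all add: word_comp_def)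
  have words: "monom_upto k (?D w) (b ^ ?E w) (\<kappa> (?W w))"
    if k: "k \<ge> 1" and g: "monom_upto k m b (\<kappa> g)" for k w
  proof (induction w)
    case Nil
    then show ?case by (simp add: word_comp_Nil \<kappa>X monom_upto_def)
  next
    case (Cons x w)
    have x: "monom_upto k (if x then n else m) (if x then 1 else b) (\<kappa> (?W [x]))"
      using g \<kappa>f_upto by (cases x) (simp_all add: letters)
    \<comment> \<open>Composition needs inner degree at least 2, which the empty word lacks.\<close>
    show ?case
    proof (cases "w = []")
      case True
      then show ?thesis using x by (cases x) simp_all
    next
      case False
      show ?thesis
        using monom_upto_compose(1)[OF x Cons.IH k word_degree_ge_2[OF nm(1,2) False]]
          \<kappa>W[of "[x]" w]
        by (cases x) (simp_all add: mult.commute flip: power_mult)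
    qed
  qed
  have deg_eq: "?D u * n = ?D v * m"
    using arg_cong[OF rel, of Polynomial.degree] by (simp add: degW word_degree_append)
  \<comment> \<open>Induction on the gap, starting from the leading term; the relation kills one
    further coefficient of \<open>\<kappa> g\<close> at a time.\<close>
  have g_upto: "monom_upto (Suc k) m b (\<kappa> g)" for k
  proof (induction k)
    case 0
    have "\<kappa> g $ i = 0" if "i < m" for i
      using that subg by (intro nth_less_subdegree_zero) simp
    then show ?case by (simp add: monom_upto_def b_def less_Suc_eq)
  next
    case (Suc k)
    let ?k = "Suc k"
    \<comment> \<open>The inner letter decides this coefficient, and \<open>\<kappa> f\<close> is
      exactly s^n.\<close>
    have "\<kappa> (?W (u @ [True])) $ (?D u * n + ?k) = 0"
      using monom_upto_compose(2)[OF words[OF _ Suc.IH, of u] \<kappa>f_upto] nm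
      by (simp add: \<kappa>W letters \<kappa>f fps_X_power_nth)
    moreover have "b * \<kappa> (?W (v @ [False])) $ (?D v * m + ?k) =
        b ^ ?E v * of_nat (?D v) * b ^ ?D v * \<kappa> g $ (m + ?k)"
      using monom_upto_compose(2)[OF words[OF _ Suc.IH, of v] Suc.IH] nm
      by (simp add: \<kappa>W letters)
    \<comment> \<open>With b nonzero, this makes the factor of \<open>\<kappa> g $ (m + ?k)\<close>
      nonzero.\<close>
    moreover have "of_nat (?D v) \<noteq> (0 :: 'a)"
      using tame by (intro of_nat_word_degree_nonzero) (simp_all add: n_def m_def)
    ultimately have "\<kappa> g $ (m + ?k) = 0"
      using rel deg_eq \<open>b \<noteq> 0\<close> by simp
    then show ?case
      using Suc.IH by (auto simp: monom_upto_def less_Suc_eq)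
  qed
  \<comment> \<open>The gap \<open>Suc i\<close> reaches index i.\<close>
  have \<kappa>W_nth: "\<kappa> (?W w) $ i = (if i = ?D w then b ^ ?E w else 0)" for w i
    using words[OF _ g_upto[of i], of w] by (simp add: monom_upto_def)
  have W_eqI: "?W x = ?W y" if "?D x = ?D y" "b ^ ?E x = b ^ ?E y" for x y
    using that by (intro \<kappa>inj degW(2) fps_ext) (simp add: \<kappa>W_nth)

  \<comment> \<open>Difference of the exponents of b on the two sides of the relation.\<close>
  define e where "e = ?E v + ?D v - ?E u"
  have less: "?E u < ?D v" using word_exponent_less_degree nm deg_eq by blast
  have "b ^ ?E (u @ [True]) = b ^ ?E (v @ [False])"
    using \<kappa>W_nth[of "u @ [True]" "?D u * n"] \<kappa>W_nth[of "v @ [False]" "?D u * n"] rel deg_eq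
    by (simp add: word_degree_append)
  moreover have "?E (u @ [True]) = ?E u" "?E (v @ [False]) = ?E u + e"
    using less by (simp_all add: e_def word_exponent_append)
  ultimately have "b ^ ?E u * 1 = b ^ ?E u * b ^ e"
    by (metis mult.right_neutral power_add)
  then have be: "b ^ e = 1" using \<open>b \<noteq> 0\<close> by simp
  have "e > 0" using less by (simp add: e_def)
  then obtain i p where "p > 0" and per: "\<And>a. n ^ (i + p * a) mod e = n ^ i mod e"
    using power_mod_eventually_periodic[of e n] by blast
  show thesis
  proof (rule that)
    show "p > 0" by fact
    fix a k
    show "?W (replicate (i + p * a) True @ replicate k False) =
      ?W (replicate i True @ replicate k False @ replicate (p * a) True)"
    proof (rule W_eqI)
      \<comment> \<open>These are the two exponents; the trailing copies of \<open>f\<close> add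
        0.\<close>
      have "n ^ (i + p * a) * ?E (replicate k False) mod e = n ^ i * ?E (replicate k False) mod e"
        using per by (metis mod_mult_left_eq)
      then show "b ^ ?E (replicate (i + p * a) True @ replicate k False) =
          b ^ ?E (replicate i True @ replicate k False @ replicate (p * a) True)"
        using be by (intro power_eq_of_mod_eq)
          (simp_all add: word_exponent_append word_exponent_replicate_True word_degree_replicate)
    qed (simp add: word_degree_append word_degree_replicate power_add)
  qed
qed

subsection \<open>Preperiodic points\<close>

lemma word_comp_swap: "word_comp g f (map Not w) = word_comp f g w"
  by (induction w) (simp_all add: word_comp_Nil word_comp_Cons)

lemma poly_word_comp_replicate:
  "poly (word_comp f g (replicate j x)) z = (poly (if x then f else g) ^^ j) z"
  by (induction j) (auto simp: word_comp_Nil word_comp_Cons poly_pcompose)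

text \<open>Compare last letters: equal ones cancel, as right composition with a nonconstant
  polynomial is injective; different ones contradict \<open>no_rel\<close>. Degrees separate
  nonempty words from the identity.\<close>

lemma free_semigroup_onI:
  fixes f g :: "'a::field poly"
  assumes degs: "Polynomial.degree f \<ge> 2" "Polynomial.degree g \<ge> 2"
    and no_rel: "\<And>u v. word_comp f g (u @ [True]) \<noteq> word_comp f g (v @ [False])"
  shows "free_semigroup_on f g"
proof -
  let ?W = "word_comp f g"
  have nontrivial: "?W w \<noteq> ?W []" if "w \<noteq> []" for w
    using word_degree_ge_2[OF degs that] degree_word_comp[of f g w] degree_word_comp[of f g "[]"]
    by auto
  have cancel: "?W u = ?W v" if "?W (u @ [x]) = ?W (v @ [x])" for u v x
  proof -
    have "Polynomial.degree (?W [x]) > 0"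
      using degs by (cases x) (simp_all add: degree_word_comp)
    moreover have "pcompose (?W u - ?W v) (?W [x]) = 0"
      using that by (simp add: word_comp_append pcompose_diff)
    ultimately show ?thesis by (simp add: pcompose_eq_0_iff)
  qed
  have "?W u = ?W v \<Longrightarrow> u = v" for u v
  proof (induction u arbitrary: v rule: rev_induct)
    case Nil
    then show ?case using nontrivial by metis
  next
    case (snoc x u)
    show ?case
    proof (cases v rule: rev_exhaust)
      case Nil
      then show ?thesis using snoc.prems nontrivial by blast
    next
      case (snoc v' y)
      have "x = y"
        using snoc.prems no_rel[of u v'] no_rel[of v' u] snoc by (cases x; cases y) auto
      then show ?thesis using snoc snoc.IH[of v'] snoc.prems cancel by blast
    qed
  qed
  then show ?thesis by (auto simp: free_semigroup_on_def inj_on_def)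
qed

definition preperiodic :: "('a \<Rightarrow> 'a) \<Rightarrow> 'a \<Rightarrow> bool" where
  "preperiodic h x \<longleftrightarrow> finite (range (\<lambda>n. (h ^^ n) x))"

lemma preperiodic_imp_period:
  assumes "preperiodic h x"
  shows "\<exists>i d. d > 0 \<and> (\<forall>j a. j \<ge> i \<longrightarrow> (h ^^ (j + d * a)) x = (h ^^ j) x)"
proof -
  have "\<not> inj (\<lambda>n. (h ^^ n) x)"
    using assms finite_imageD infinite_UNIV_nat unfolding preperiodic_def by blast
  then obtain i k where "i < k" and ik: "(h ^^ k) x = (h ^^ i) x"
    by (auto simp: inj_def) (metis linorder_neqE_nat)
  define d where "d = k - i"
  have step: "(h ^^ (j + d)) x = (h ^^ j) x" if "j \<ge> i" for j
  proof -
    have "(h ^^ (j + d)) x = (h ^^ ((j - i) + k)) x"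
      using that \<open>i < k\<close> by (simp add: d_def)
    also have "\<dots> = (h ^^ ((j - i) + i)) x" by (simp add: funpow_add ik)
    finally show ?thesis using that by simp
  qed
  have "(h ^^ (j + d * a)) x = (h ^^ j) x" if "j \<ge> i" for j a
    using that by (induction a) (use step[of "j + d * _"] in \<open>auto simp: algebra_simps\<close>)
  moreover have "d > 0" using \<open>i < k\<close> by (simp add: d_def)
  ultimately show ?thesis by blast
qed

lemma preperiodic_poly_transfer:
  fixes f g :: "'a::alg_closed_field poly"
  assumes degs: "Polynomial.degree f \<ge> 2" "Polynomial.degree g \<ge> 2"
    and tame: "of_nat (Polynomial.degree f) \<noteq> (0 :: 'a)"
      "of_nat (Polynomial.degree g) \<noteq> (0 :: 'a)"
    and rel: "word_comp f g (u @ [True]) = word_comp f g (v @ [False])"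
    and x: "preperiodic (poly f) x"
  shows "preperiodic (poly g) x"
proof (rule relation_imp_semicommuting_iterates[OF degs tame rel])
  let ?W = "word_comp f g"
  fix i p :: nat
  assume "p > 0" and comm:
    "\<And>a k. ?W (replicate (i + p * a) True @ replicate k False) =
      ?W (replicate i True @ replicate k False @ replicate (p * a) True)"
  have iter: "(poly f ^^ (i + p * a)) ((poly g ^^ k) x) =
      (poly f ^^ i) ((poly g ^^ k) ((poly f ^^ (p * a)) x))" for a k
    using arg_cong[OF comm[of a k], of "\<lambda>h. poly h x"]
    by (simp add: word_comp_append poly_pcompose poly_word_comp_replicate)
  obtain l d where "d > 0" and per: "\<And>j a. j \<ge> l \<Longrightarrow> (poly f ^^ (j + d * a)) x = (poly f ^^ j) x"
    using preperiodic_imp_period[OF x] by blast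
  have "p * l \<ge> l" using \<open>p > 0\<close> by simp
  \<comment> \<open>Multiples of p fit \<open>iter\<close>; p * l is past the preperiod bound l, and
    p * d is a multiple of d.\<close>
  then have fx: "(poly f ^^ (p * (l + d))) x = (poly f ^^ (p * l)) x"
    using per[of "p * l" p] by (simp add: algebra_simps)
  define A B where "A = i + p * (l + d)" and "B = i + p * l"
  \<comment> \<open>\<open>P\<close> does not depend on k: by \<open>iter\<close> and
    \<open>fx\<close>, f^A and f^B agree at every g^k(x).\<close>
  define P where "P = ?W (replicate A True) - ?W (replicate B True)"
  have "B < A" using \<open>p > 0\<close> \<open>d > 0\<close> by (simp add: A_def B_def)
  then have "Polynomial.degree f ^ B < Polynomial.degree f ^ A"
    using degs by (intro power_strict_increasing) auto
  then have "P \<noteq> 0"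
    using degree_word_comp[of f g "replicate A True"] degree_word_comp[of f g "replicate B True"]
    by (auto simp: P_def word_degree_replicate)
  then have "finite {y. poly P y = 0}" by (rule poly_roots_finite)
  moreover have "range (\<lambda>k. (poly g ^^ k) x) \<subseteq> {y. poly P y = 0}"
    by (auto simp: P_def poly_word_comp_replicate A_def B_def iter fx)
  ultimately show ?thesis unfolding preperiodic_def by (rule finite_subset[rotated])
qed

text \<open>Infinity is fixed, so only affine points can distinguish two such sets.\<close>

lemma Prep_eq:
  fixes f :: "'a::field poly"
  assumes "Polynomial.degree f > 0"
  shows "Prep f = insert Infty (Aff ` {x. preperiodic (poly (map_poly to_ac f)) x})"
proof -
  let ?f = "map_poly to_ac f"
  have "Polynomial.degree ?f = Polynomial.degree f" by (simp add: degree_map_poly)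
  then have "(poly_proj ?f ^^ n) Infty = Infty" for n
    using assms by (induction n) auto
  moreover have "(poly_proj ?f ^^ n) (Aff x) = Aff ((poly ?f ^^ n) x)" for n x
    by (induction n) auto
  moreover have "finite (range (\<lambda>n. Aff (h n))) \<longleftrightarrow> finite (range h)"
    for h :: "nat \<Rightarrow> 'a alg_closure"
    using finite_image_iff[of Aff "range h"] by (simp add: image_image inj_on_def)
  ultimately have "Infty \<in> Prep f" "Aff x \<in> Prep f \<longleftrightarrow> preperiodic (poly ?f) x" for x
    by (simp_all add: Prep_def preperiodic_def)
  then have "P \<in> Prep f \<longleftrightarrow> P \<in> insert Infty (Aff ` {x. preperiodic (poly ?f) x})" for P
    by (cases P) auto
  then show ?thesis by blast
qed

lemma map_poly_to_ac_word_comp: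
  "map_poly to_ac (word_comp f g w) = word_comp (map_poly to_ac f) (map_poly to_ac g) w"
  by (induction w) (simp_all add: word_comp_Nil word_comp_Cons map_poly_pcompose_hom map_poly_pCons)

theorem theorem1p5:
  fixes f g :: "'a::field poly"
  assumes "Polynomial.degree f > 1" and "Polynomial.degree g > 1"
    and "\<not> CHAR('a) dvd Polynomial.degree f"
    and "\<not> CHAR('a) dvd Polynomial.degree g"
    and "Prep f \<noteq> Prep g"
  shows "free_semigroup_on f g"
proof (rule free_semigroup_onI)
  show degs: "Polynomial.degree f \<ge> 2" "Polynomial.degree g \<ge> 2" using assms by auto
  fix u v
  let ?f = "map_poly to_ac f" and ?g = "map_poly to_ac g"
  have deg_ac: "Polynomial.degree (map_poly to_ac p) = Polynomial.degree p" for p :: "'a poly"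
    by (simp add: degree_map_poly)
  \<comment> \<open>The embedding \<open>to_ac\<close> is injective, so the characteristic is
    preserved.\<close>
  have tame: "of_nat d \<noteq> (0 :: 'a alg_closure)" if "\<not> CHAR('a) dvd d" for d
    using that by (metis of_nat_eq_0_iff_char_dvd to_ac_eq_0_iff to_ac_of_nat)
  show "word_comp f g (u @ [True]) \<noteq> word_comp f g (v @ [False])"
  proof
    assume "word_comp f g (u @ [True]) = word_comp f g (v @ [False])"
    then have rel: "word_comp ?f ?g (u @ [True]) = word_comp ?f ?g (v @ [False])"
      by (metis map_poly_to_ac_word_comp)
    \<comment> \<open>Exchanging \<open>f\<close> and \<open>g\<close> negates the letters; swapping
      the sides restores the shape needed for the reverse inclusion.\<close>
    then have rel': "word_comp ?g ?f (map Not v @ [True]) = word_comp ?g ?f (map Not u @ [False])"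
      using word_comp_swap[of ?g ?f "v @ [False]"] word_comp_swap[of ?g ?f "u @ [True]"] by simp
    have "preperiodic (poly ?f) x \<longleftrightarrow> preperiodic (poly ?g) x" for x
      using preperiodic_poly_transfer[OF _ _ _ _ rel] preperiodic_poly_transfer[OF _ _ _ _ rel']
        degs tame assms(3,4) by (auto simp: deg_ac)
    then show False using assms by (simp add: Prep_eq)
  qed
qed

end
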